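(* Let $A$ and $B$ be permutation matrices with $A\preceq_s B$. Then for any permutation matrix $C$, \[\left( \begin{array}{c|c} A & 0\\ \hline 0 & C \end{array} \right) \preceq_s \left(\begin{array}{c|c} B & 0\\ \hline 0 & C \end{array} \right).\] Equivalently, if $A,B,C$ are the matrices of permutations $\alpha,\beta,\gamma$ and $|S_Y(\alpha)|\le|S_Y(\beta)|$ for all (proper) Young diagrams $Y$, then $|S_Y(\alpha|\gamma)|\le|S_Y(\beta|\gamma)|$ for all (proper) Young diagrams $Y$.
   Context: Permutation matrices are coordinatized from the bottom left corner: the matrix of a permutation $\pi\in S_n$ has its $1$ of column $i$ (from the left) in row $\pi(i)$ (counted from the bottom). Thus, if $\alpha\in S_m$ and $\gamma\in S_k$ have matrices $A$ and $C$, the block matrix with $A$ in the upper left and $C$ in the lower right is the matrix of $(\alpha|\gamma)=(\alpha(1)+k,\ldots,\alpha(m)+k,\gamma(1),\ldots,\gamma(k))\in S_{m+k}$. $Y(a_1,\ldots,a_n)$, with $a_1\ge a_2\ge\cdots\ge a_n\ge 1$, denotes the left-justified Young diagram whose $i$-th row from the top has $a_i$ cells. $(x,y)$ denotes the cell in column $x$ (from the left) and row $y$ (from the bottom). A Young diagram of size $n$ is proper if it has exactly $n$ rows and $n$ columns and contains the staircase $Y(n,n-1,\ldots,2,1)$; all Young diagrams are assumed proper. A transversal $T$ of $Y$ is a set of $n$ cells of $Y$ with exactly one in every row and every column; equivalently a permutation $\pi$ of $\{1,\ldots,n\}$ such that every cell $(x,\pi(x))$ lies in $Y$. $T$ contains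 the pattern $\rho\in S_l$ in $Y$ if there are columns $x_1<\cdots<x_l$ such that $(\pi(x_1),\ldots,\pi(x_l))$ is order-isomorphic to $\rho$ and the cell $(x_l,\min_j\pi(x_j))$ belongs to $Y$. $S_Y(\rho)$ is the set of transversals of $Y$ that do not contain $\rho$ in $Y$. For permutations (or their matrices) $\rho\preceq_s\rho'$ means $|S_Y(\rho)|\le|S_Y(\rho')|$ for all Young diagrams $Y$. *)

theory Defs
  imports "HOL-Combinatorics.Permutations"
begin

text \<open>
  A Young diagram \<open>Y(a\<^sub>1, \<dots>, a\<^sub>n)\<close> is given by the list of its row lengths, from the top row to
  the bottom row. Its cells are pairs (column, row), both starting at 1; columns are counted from
  the left but rows from the bottom, so row \<open>y\<close> is the \<open>(n + 1 - y)\<close>-th row from the top.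
\<close>

definition cells :: "nat list \<Rightarrow> (nat \<times> nat) set" where
  "cells a = {(x, y). 1 \<le> y \<and> y \<le> length a \<and> 1 \<le> x \<and> x \<le> a ! (length a - y)}"

definition young_diagram :: "nat list \<Rightarrow> bool" where
  "young_diagram a \<longleftrightarrow> sorted_wrt (\<ge>) a \<and> (\<forall>r\<in>set a. 1 \<le> r)"

definition staircase :: "nat \<Rightarrow> nat list" where
  "staircase n = rev [1..<Suc n]"

text \<open>The number of columns is the length \<open>hd a\<close> of the top row. Both diagrams in the inclusion
  have the same number of rows, so their bottom-left coordinates agree.\<close>

definition proper_young_diagram :: "nat list \<Rightarrow> bool" where
  "proper_young_diagram a \<longleftrightarrow>
     a \<noteq> [] \<and> young_diagram a \<and> hd a = length a \<and> cells (staircase (length a)) \<subseteq> cells a"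

definition transversal :: "nat list \<Rightarrow> (nat \<Rightarrow> nat) \<Rightarrow> bool" where
  "transversal a \<pi> \<longleftrightarrow> \<pi> permutes {1..length a} \<and> (\<forall>x\<in>{1..length a}. (x, \<pi> x) \<in> cells a)"

text \<open>A permutation in \<open>S\<^sub>l\<close> is a function \<open>\<rho>\<close> with \<open>\<rho> permutes {1..l}\<close>; its size \<open>l\<close> is passed
  explicitly, as it is not determined by the function. Patterns have size \<open>l \<ge> 1\<close>.\<close>

definition contains_in :: "nat list \<Rightarrow> (nat \<Rightarrow> nat) \<Rightarrow> nat \<Rightarrow> (nat \<Rightarrow> nat) \<Rightarrow> bool" where
  "contains_in a \<pi> l \<rho> \<longleftrightarrow>
     (\<exists>x :: nat \<Rightarrow> nat.
        x ` {1..l} \<subseteq> {1..length a} \<and> strict_mono_on {1..l} x \<and>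
        (\<forall>i\<in>{1..l}. \<forall>j\<in>{1..l}. \<pi> (x i) < \<pi> (x j) \<longleftrightarrow> \<rho> i < \<rho> j) \<and>
        (x l, Min ((\<lambda>j. \<pi> (x j)) ` {1..l})) \<in> cells a)"

definition avoiders :: "nat list \<Rightarrow> nat \<Rightarrow> (nat \<Rightarrow> nat) \<Rightarrow> (nat \<Rightarrow> nat) set" where
  "avoiders a l \<rho> = {\<pi>. transversal a \<pi> \<and> \<not> contains_in a \<pi> l \<rho>}"

definition shape_le :: "nat \<Rightarrow> (nat \<Rightarrow> nat) \<Rightarrow> nat \<Rightarrow> (nat \<Rightarrow> nat) \<Rightarrow> bool" where
  "shape_le l \<rho> l' \<rho>' \<longleftrightarrow>
     (\<forall>a. proper_young_diagram a \<longrightarrow> card (avoiders a l \<rho>) \<le> card (avoiders a l' \<rho>'))"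

text \<open>The permutation \<open>(\<alpha>|\<gamma>) = (\<alpha>(1) + k, \<dots>, \<alpha>(m) + k, \<gamma>(1), \<dots>, \<gamma>(k))\<close> of size \<open>m + k\<close>,
  whose matrix has the matrix of \<open>\<alpha>\<close> as its upper left block and that of \<open>\<gamma>\<close> as its lower right
  block (rows being counted from the bottom).\<close>

definition block_perm :: "nat \<Rightarrow> (nat \<Rightarrow> nat) \<Rightarrow> nat \<Rightarrow> (nat \<Rightarrow> nat) \<Rightarrow> nat \<Rightarrow> nat" where
  "block_perm m \<alpha> k \<gamma> i =
     (if i \<in> {1..m} then \<alpha> i + k
      else if i \<in> {m + 1..m + k} then \<gamma> (i - m)
      else i)"

lemma block_perm_permutes:
  assumes "\<alpha> permutes {1..m}" "\<gamma> permutes {1..k}"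
  shows "block_perm m \<alpha> k \<gamma> permutes {1..m + k}"
proof (rule bij_imp_permutes)
  have a: "\<alpha> i \<in> {1..m}" if "i \<in> {1..m}" for i
    using permutes_in_image[OF assms(1)] that by blast
  have c: "\<gamma> i \<in> {1..k}" if "i \<in> {1..k}" for i
    using permutes_in_image[OF assms(2)] that by blast
  have c': "\<gamma> (i - m) \<in> {1..k}" if "i \<in> {m + 1..m + k}" for i
    using that by (intro c) auto
  have "inj_on (block_perm m \<alpha> k \<gamma>) {1..m + k}"
  proof (rule inj_onI)
    fix i j
    assume ij: "i \<in> {1..m + k}" "j \<in> {1..m + k}"
      and eq: "block_perm m \<alpha> k \<gamma> i = block_perm m \<alpha> k \<gamma> j"
    consider "i \<le> m" "j \<le> m" | "i \<le> m" "m < j" | "m < i" "j \<le> m" | "m < i" "m < j"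
      by linarith
    then show "i = j"
    proof cases
      case 1
      then have "\<alpha> i = \<alpha> j" using eq ij by (simp add: block_perm_def)
      then show ?thesis using permutes_inj[OF assms(1)] by (auto dest: injD)
    next
      case 2
      then show ?thesis using eq ij a[of i] c'[of j] by (simp add: block_perm_def)
    next
      case 3
      then show ?thesis using eq ij a[of j] c'[of i] by (simp add: block_perm_def)
    next
      case 4
      then have "\<gamma> (i - m) = \<gamma> (j - m)" using eq ij by (simp add: block_perm_def)
      then have "i - m = j - m" using permutes_inj[OF assms(2)] by (auto dest: injD)
      then show ?thesis using 4 by simp
    qed
  qed
  moreover have "block_perm m \<alpha> k \<gamma> ` {1..m + k} \<subseteq> {1..m + k}"
  proof (rule image_subsetI)
    fix i assume "i \<in> {1..m + k}"
    then show "block_perm m \<alpha> k \<gamma> i \<in> {1..m + k}"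
      using a[of i] c'[of i] by (cases "i \<le> m") (auto simp: block_perm_def)
  qed
  ultimately show "bij_betw (block_perm m \<alpha> k \<gamma>) {1..m + k} {1..m + k}"
    by (simp add: bij_betw_def endo_inj_surj)
qed (auto simp: block_perm_def)

end

theory Submission
  imports Defs "HOL-Library.Infinite_Set"
begin

text \<open>
  Fix a proper Young diagram \<open>Y\<close>. For a transversal \<open>\<pi>\<close> of \<open>Y\<close> let \<open>W(\<pi>)\<close> be the set of cells of
  \<open>Y\<close> that have an occurrence of \<open>\<gamma>\<close> in \<open>Y\<close> strictly to the right of and strictly below them. An
  occurrence of \<open>(\<alpha>|\<gamma>)\<close> consists of an occurrence of \<open>\<alpha>\<close> and one of \<open>\<gamma>\<close> to the right of and below
  it, so \<open>\<pi>\<close> contains \<open>(\<alpha>|\<gamma>)\<close> in \<open>Y\<close> if and only if it has an occurrence of \<open>\<alpha>\<close> whose grid lies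
  in \<open>W(\<pi>)\<close> (\<open>occurs_block_imp_occurs_dominating\<close>, \<open>occurs_dominating_imp_occurs_block\<close>).

  The set \<open>W(\<pi>)\<close> is closed under moving left and up, and it does not change when the cells of \<open>\<pi>\<close>
  inside \<open>W(\<pi>)\<close> are replaced by other cells of \<open>W(\<pi>)\<close> in the same rows and columns
  (\<open>dominating_eqI\<close>). For the inclusion of the old set in the new one, every cell of \<open>W(\<pi>)\<close> is to
  the left of and above a cell of \<open>W(\<pi>)\<close> that lies as far to the right as possible, and an
  occurrence of \<open>\<gamma>\<close> that witnesses the latter avoids \<open>W(\<pi>)\<close>, hence survives. Conversely, an occurrence of
  \<open>\<gamma>\<close> to the right of and below a cell outside \<open>W(\<pi>)\<close> avoids \<open>W(\<pi>)\<close>, hence was there before.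

  Classify the transversals of \<open>Y\<close> by \<open>W(\<pi>)\<close> and the cells of \<open>\<pi>\<close> outside \<open>W(\<pi>)\<close>. By the above,
  a class arises from any of its members by rearranging the cells inside \<open>W\<close> in all possible ways
  (\<open>dominating_class_eq_iff\<close>). Deleting the rows and columns of the cells outside \<open>W\<close> identifies the
  class with the set of all transversals of a smaller Young diagram, which is proper because it has
  a transversal, and the members avoiding \<open>(\<alpha>|\<gamma>)\<close> in \<open>Y\<close> with the transversals avoiding \<open>\<alpha>\<close> in
  the smaller diagram (\<open>fibre_relabel\<close>). The hypothesis on \<open>\<alpha>\<close> and \<open>\<beta>\<close> therefore gives the
  inequality in each class, and the claim follows by summation. In a class with empty smaller
  diagram, no member contains any of the two block patterns.
\<close>

section \<open>Up-left-closed sets and proper Young diagrams\<close>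

text \<open>A set of cells in the \<open>n \<times> n\<close> square that is closed under moving left and up.\<close>

definition up_left :: "nat \<Rightarrow> (nat \<times> nat) set \<Rightarrow> bool" where
  "up_left n D \<longleftrightarrow> D \<subseteq> {1..n} \<times> {1..n} \<and>
     (\<forall>x y x' y'. (x, y) \<in> D \<longrightarrow> 1 \<le> x' \<longrightarrow> x' \<le> x \<longrightarrow> y \<le> y' \<longrightarrow> y' \<le> n \<longrightarrow> (x', y') \<in> D)"

lemma up_leftD:
  assumes "up_left n D" "(x, y) \<in> D"
  shows "1 \<le> x" "x \<le> n" "1 \<le> y" "y \<le> n"
  using assms unfolding up_left_def by auto

lemma up_left_mono:
  assumes "up_left n D" "(x, y) \<in> D" "1 \<le> x'" "x' \<le> x" "y \<le> y'" "y' \<le> n"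
  shows "(x', y') \<in> D"
  using assms unfolding up_left_def by blast

lemma up_left_cells:
  assumes "proper_young_diagram a"
  shows "up_left (length a) (cells a)"
proof -
  have ne: "a \<noteq> []" and srt: "sorted_wrt (\<ge>) a" and hd: "hd a = length a"
    using assms by (auto simp: proper_young_diagram_def young_diagram_def)
  have mono: "a ! j \<le> a ! i" if "i \<le> j" "j < length a" for i j
    using that srt by (cases "i = j") (auto simp: sorted_wrt_iff_nth_less)
  show ?thesis
    unfolding up_left_def
  proof (intro conjI allI impI subsetI)
    fix p assume "p \<in> cells a"
    then obtain x y where p: "p = (x, y)" "1 \<le> y" "y \<le> length a" "1 \<le> x" "x \<le> a ! (length a - y)"
      by (auto simp: cells_def)
    have "a ! (length a - y) \<le> a ! 0" using p by (intro mono) auto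
    then show "p \<in> {1..length a} \<times> {1..length a}" using p ne hd by (auto simp: hd_conv_nth)
  next
    fix x y x' y'
    assume h: "(x, y) \<in> cells a" "1 \<le> x'" "x' \<le> x" "y \<le> y'" "y' \<le> length a"
    then have "a ! (length a - y) \<le> a ! (length a - y')"
      by (intro mono) (auto simp: cells_def)
    then show "(x', y') \<in> cells a" using h by (auto simp: cells_def)
  qed
qed

lemma initial_segment:
  fixes S :: "nat set"
  assumes "finite S" "0 \<notin> S" "\<And>x x'. x \<in> S \<Longrightarrow> 1 \<le> x' \<Longrightarrow> x' \<le> x \<Longrightarrow> x' \<in> S"
  shows "S = {1..card S}"
proof (cases "S = {}")
  case False
  have "S = {1..Max S}"
  proof
    show "S \<subseteq> {1..Max S}"
    proof
      fix x assume "x \<in> S"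
      then show "x \<in> {1..Max S}" using assms by (cases x) auto
    qed
    show "{1..Max S} \<subseteq> S" using assms(3)[OF Max_in[OF assms(1) False]] by auto
  qed
  then show ?thesis by (metis card_atLeastAtMost diff_Suc_1)
qed simp

lemma cells_staircase: "cells (staircase n) = {(x, y). 1 \<le> x \<and> x \<le> y \<and> y \<le> n}"
proof -
  have "staircase n ! (n - y) = y" if "1 \<le> y" "y \<le> n" for y
    using that by (simp add: staircase_def rev_nth del: upt_Suc)
  then show ?thesis unfolding cells_def by (auto simp: staircase_def simp del: upt_Suc)
qed

text \<open>The staircase condition comes for free from a transversal \<open>\<sigma>\<close>: one of the \<open>y\<close> columns that
  \<open>\<sigma>\<close> sends to the bottom \<open>y\<close> rows has index at least \<open>y\<close>, so row \<open>y\<close> has length at least \<open>y\<close>.\<close>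

lemma up_left_is_proper_diagram:
  assumes E: "up_left p E" and p: "1 \<le> p"
    and \<sigma>: "\<sigma> permutes {1..p}" "\<And>x. x \<in> {1..p} \<Longrightarrow> (x, \<sigma> x) \<in> E"
  obtains a where "proper_young_diagram a" "length a = p" "cells a = E"
proof -
  define row where "row y = {x. (x, y) \<in> E}" for y
  define a where "a = map (\<lambda>i. card (row (p - i))) [0..<p]"
  have len: "length a = p" by (simp add: a_def)
  have sub: "row y \<subseteq> {1..p}" for y using up_leftD[OF E] by (auto simp: row_def)
  have fin: "finite (row y)" for y by (rule finite_subset[OF sub]) simp
  have row: "row y = {1..card (row y)}" if y: "y \<in> {1..p}" for y
  proof (rule initial_segment[OF fin])
    show "0 \<notin> row y" using sub by fastforce
    show "x' \<in> row y" if "x \<in> row y" "1 \<le> x'" "x' \<le> x" for x x'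
      using up_left_mono[OF E _ that(2,3), of y y] that(1) y by (auto simp: row_def)
  qed
  have nth: "a ! (p - y) = card (row y)" if "y \<in> {1..p}" for y
    using that by (auto simp: a_def)
  have cells: "cells a = E"
  proof -
    have "(x, y) \<in> cells a \<longleftrightarrow> (x, y) \<in> E" for x y
    proof (cases "y \<in> {1..p}")
      case True
      then have "(x, y) \<in> cells a \<longleftrightarrow> x \<in> {1..card (row y)}"
        using nth by (auto simp: cells_def len)
      also have "\<dots> \<longleftrightarrow> x \<in> row y" using row[OF True] by blast
      finally show ?thesis by (simp add: row_def)
    next
      case False
      then show ?thesis using up_leftD[OF E] by (auto simp: cells_def len)
    qed
    then show ?thesis by auto
  qed
  have img: "\<sigma> x \<in> {1..p} \<longleftrightarrow> x \<in> {1..p}" for x using permutes_in_image[OF \<sigma>(1)] .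
  have sorted: "sorted_wrt (\<ge>) a"
  proof -
    have "card (row (p - j)) \<le> card (row (p - i))" if "i < j" "j < p" for i j
    proof (rule card_mono[OF fin])
      show "row (p - j) \<subseteq> row (p - i)"
        using up_leftD[OF E] that by (auto simp: row_def intro: up_left_mono[OF E])
    qed
    then show ?thesis by (auto simp: sorted_wrt_iff_nth_less a_def)
  qed
  have pos: "1 \<le> r" if r: "r \<in> set a" for r
  proof -
    obtain i where i: "i < p" "r = card (row (p - i))" using r by (auto simp: a_def)
    then have "p - i \<in> \<sigma> ` {1..p}" using permutes_image[OF \<sigma>(1)] by auto
    then obtain x where "x \<in> {1..p}" "p - i = \<sigma> x" by blast
    then have "x \<in> row (p - i)" using \<sigma>(2) by (simp add: row_def)
    then have "row (p - i) \<noteq> {}" by blast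
    then have "0 < card (row (p - i))" using fin by (simp add: card_gt_0_iff)
    then show ?thesis using i by simp
  qed
  have hd: "hd a = p"
  proof -
    have "row p = {1..p}"
    proof (rule antisym[OF sub subsetI])
      fix x assume x: "x \<in> {1..p}"
      have "(x, p) \<in> E" by (rule up_left_mono[OF E \<sigma>(2)[OF x]]) (use x img[of x] in auto)
      then show "x \<in> row p" by (simp add: row_def)
    qed
    then show ?thesis using p nth[of p] len by (cases a) auto
  qed
  have stair: "cells (staircase p) \<subseteq> E"
  proof -
    have "(x, y) \<in> E" if xy: "1 \<le> x" "x \<le> y" "y \<le> p" for x y
    proof -
      have "\<exists>z\<in>{1..p}. \<sigma> z \<le> y \<and> y \<le> z"
      proof (rule ccontr)
        assume no: "\<not> ?thesis"
        have "{1..y} \<subseteq> \<sigma> ` {1..<y}"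
        proof
          fix v assume v: "v \<in> {1..y}"
          then have "v \<in> \<sigma> ` {1..p}" using permutes_image[OF \<sigma>(1)] xy by auto
          then show "v \<in> \<sigma> ` {1..<y}" using no v by fastforce
        qed
        then have "card {1..y} \<le> card {1..<y}" by (intro surj_card_le) auto
        then show False using xy by simp
      qed
      then show ?thesis using up_left_mono[OF E \<sigma>(2)] xy by (metis le_trans)
    qed
    then show ?thesis by (auto simp: cells_staircase)
  qed
  have "proper_young_diagram a"
    using len cells sorted pos hd stair p
    by (auto simp: proper_young_diagram_def young_diagram_def)
  then show thesis using that len cells by blast
qed

section \<open>Occurrences of patterns\<close>

text \<open>The columns \<open>x 1 < \<dots> < x l\<close> carry a copy of \<open>\<rho>\<close> in \<open>\<pi>\<close> all of whose grid, formed by its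
  columns and its rows, lies in \<open>D\<close>. For an up-left-closed \<open>D\<close> this amounts to the lower right
  corner of the grid lying in \<open>D\<close>.\<close>

definition occurs ::
  "(nat \<times> nat) set \<Rightarrow> (nat \<Rightarrow> nat) \<Rightarrow> nat \<Rightarrow> (nat \<Rightarrow> nat) \<Rightarrow> (nat \<Rightarrow> nat) \<Rightarrow> bool" where
  "occurs D \<pi> l \<rho> x \<longleftrightarrow>
     strict_mono_on {1..l} x \<and>
     (\<forall>i\<in>{1..l}. \<forall>j\<in>{1..l}. \<pi> (x i) < \<pi> (x j) \<longleftrightarrow> \<rho> i < \<rho> j) \<and>
     (\<forall>i\<in>{1..l}. \<forall>j\<in>{1..l}. (x i, \<pi> (x j)) \<in> D)"

lemma occursD:
  assumes "occurs D \<pi> l \<rho> x" "i \<in> {1..l}" "j \<in> {1..l}"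
  shows "i < j \<Longrightarrow> x i < x j" "\<pi> (x i) < \<pi> (x j) \<longleftrightarrow> \<rho> i < \<rho> j" "(x i, \<pi> (x j)) \<in> D"
  using assms strict_mono_onD[of "{1..l}" x i j] unfolding occurs_def by auto

lemma occurs_cong:
  assumes "\<And>i. i \<in> {1..l} \<Longrightarrow> \<pi> (x i) = \<pi>' (x i)"
  shows "occurs D \<pi> l \<rho> x \<longleftrightarrow> occurs D \<pi>' l \<rho> x"
  using assms unfolding occurs_def by simp

lemma contains_in_iff_occurs:
  assumes a: "proper_young_diagram a" and \<pi>: "\<pi> permutes {1..length a}" and l: "1 \<le> l"
  shows "contains_in a \<pi> l \<rho> \<longleftrightarrow> (\<exists>x. occurs (cells a) \<pi> l \<rho> x)"
proof
  note D = up_left_cells[OF a]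
  assume "contains_in a \<pi> l \<rho>"
  then obtain x where x: "x ` {1..l} \<subseteq> {1..length a}" "strict_mono_on {1..l} x"
    "\<forall>i\<in>{1..l}. \<forall>j\<in>{1..l}. \<pi> (x i) < \<pi> (x j) \<longleftrightarrow> \<rho> i < \<rho> j"
    "(x l, Min ((\<lambda>j. \<pi> (x j)) ` {1..l})) \<in> cells a"
    unfolding contains_in_def by blast
  have "(x i, \<pi> (x j)) \<in> cells a" if ij: "i \<in> {1..l}" "j \<in> {1..l}" for i j
  proof (rule up_left_mono[OF D x(4)])
    have xi: "x i \<in> {1..length a}" "x j \<in> {1..length a}" using ij x(1) by blast+
    show "1 \<le> x i" using xi by simp
    show "x i \<le> x l"
      using ij strict_mono_onD[OF x(2), of i l] by (cases "i = l") auto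
    show "Min ((\<lambda>j. \<pi> (x j)) ` {1..l}) \<le> \<pi> (x j)" using ij by simp
    show "\<pi> (x j) \<le> length a" using permutes_in_image[OF \<pi>, of "x j"] xi by auto
  qed
  then have "occurs (cells a) \<pi> l \<rho> x" using x by (simp add: occurs_def)
  then show "\<exists>x. occurs (cells a) \<pi> l \<rho> x" by blast
next
  note D = up_left_cells[OF a]
  assume "\<exists>x. occurs (cells a) \<pi> l \<rho> x"
  then obtain x where x: "occurs (cells a) \<pi> l \<rho> x" ..
  have "Min ((\<lambda>j. \<pi> (x j)) ` {1..l}) \<in> (\<lambda>j. \<pi> (x j)) ` {1..l}"
    using l by (intro Min_in) auto
  then have "(x l, Min ((\<lambda>j. \<pi> (x j)) ` {1..l})) \<in> cells a"
    using occursD(3)[OF x, of l] l by force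
  moreover have "x ` {1..l} \<subseteq> {1..length a}"
    using up_leftD[OF D] occursD(3)[OF x] by fastforce
  ultimately show "contains_in a \<pi> l \<rho>"
    using x unfolding contains_in_def occurs_def by blast
qed

section \<open>The cells that dominate an occurrence\<close>

text \<open>The cells of \<open>D\<close> strictly to the left of and strictly above some occurrence of \<open>\<gamma>\<close>.\<close>

definition dominating ::
  "(nat \<times> nat) set \<Rightarrow> nat \<Rightarrow> (nat \<Rightarrow> nat) \<Rightarrow> (nat \<Rightarrow> nat) \<Rightarrow> (nat \<times> nat) set" where
  "dominating D k \<gamma> \<pi> =
     {(x, y) \<in> D. \<exists>z. occurs D \<pi> k \<gamma> z \<and> (\<forall>i\<in>{1..k}. x < z i \<and> \<pi> (z i) < y)}"

lemma dominatingI: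
  assumes "(x, y) \<in> D" "occurs D \<pi> k \<gamma> z" "\<And>i. i \<in> {1..k} \<Longrightarrow> x < z i" "\<And>i. i \<in> {1..k} \<Longrightarrow> \<pi> (z i) < y"
  shows "(x, y) \<in> dominating D k \<gamma> \<pi>"
  using assms unfolding dominating_def by blast

lemma dominatingE:
  assumes "(x, y) \<in> dominating D k \<gamma> \<pi>"
  obtains z where "(x, y) \<in> D" "occurs D \<pi> k \<gamma> z"
    "\<And>i. i \<in> {1..k} \<Longrightarrow> x < z i" "\<And>i. i \<in> {1..k} \<Longrightarrow> \<pi> (z i) < y"
  using assms unfolding dominating_def by blast

lemma dominating_subset: "dominating D k \<gamma> \<pi> \<subseteq> D"
  by (auto simp: dominating_def)

lemma up_left_dominating:
  assumes D: "up_left n D"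
  shows "up_left n (dominating D k \<gamma> \<pi>)"
  unfolding up_left_def
proof (intro conjI allI impI)
  show "dominating D k \<gamma> \<pi> \<subseteq> {1..n} \<times> {1..n}"
    using D dominating_subset unfolding up_left_def by blast
  fix x y x' y'
  assume xy: "(x, y) \<in> dominating D k \<gamma> \<pi>" and le: "1 \<le> x'" "x' \<le> x" "y \<le> y'" "y' \<le> n"
  from xy obtain z where "(x, y) \<in> D" "occurs D \<pi> k \<gamma> z"
    "\<And>i. i \<in> {1..k} \<Longrightarrow> x < z i" "\<And>i. i \<in> {1..k} \<Longrightarrow> \<pi> (z i) < y"
    by (rule dominatingE) blast
  then show "(x', y') \<in> dominating D k \<gamma> \<pi>"
    using le by (intro dominatingI[of _ _ _ _ _ _ z]) (auto intro: up_left_mono[OF D] less_le_trans le_less_trans)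
qed

lemma occurs_block_imp_occurs_dominating:
  assumes \<alpha>: "\<alpha> permutes {1..m}" and \<gamma>: "\<gamma> permutes {1..k}"
    and x: "occurs D \<pi> (m + k) (block_perm m \<alpha> k \<gamma>) x"
  shows "occurs (dominating D k \<gamma> \<pi>) \<pi> m \<alpha> x"
proof -
  let ?z = "\<lambda>i. x (m + i)"
  have z: "occurs D \<pi> k \<gamma> ?z"
    unfolding occurs_def
  proof (intro conjI ballI strict_mono_onI)
    fix i j assume ij: "i \<in> {1..k}" "j \<in> {1..k}"
    show "i < j \<Longrightarrow> ?z i < ?z j" using ij by (auto intro: occursD(1)[OF x])
    show "\<pi> (?z i) < \<pi> (?z j) \<longleftrightarrow> \<gamma> i < \<gamma> j"
      using occursD(2)[OF x, of "m + i" "m + j"] ij by (simp add: block_perm_def)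
    show "(?z i, \<pi> (?z j)) \<in> D" using ij by (auto intro: occursD(3)[OF x])
  qed
  have below: "\<pi> (?z j) < \<pi> (x i)" if "i \<in> {1..m}" "j \<in> {1..k}" for i j
    using occursD(2)[OF x, of "m + j" i] that
      permutes_in_image[OF \<gamma>, of j] permutes_in_image[OF \<alpha>, of i]
    by (auto simp: block_perm_def)
  show ?thesis
    unfolding occurs_def
  proof (intro conjI ballI strict_mono_onI)
    fix i j assume ij: "i \<in> {1..m}" "j \<in> {1..m}"
    show "i < j \<Longrightarrow> x i < x j" using ij by (auto intro: occursD(1)[OF x])
    show "\<pi> (x i) < \<pi> (x j) \<longleftrightarrow> \<alpha> i < \<alpha> j"
      using occursD(2)[OF x, of i j] ij by (simp add: block_perm_def)
    show "(x i, \<pi> (x j)) \<in> dominating D k \<gamma> \<pi>"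
      using ij z below by (intro dominatingI[of _ _ _ _ _ _ ?z])
        (auto intro: occursD(3)[OF x] occursD(1)[OF x])
  qed
qed

lemma occurs_dominating_imp_occurs_block:
  assumes D: "up_left n D" and m: "1 \<le> m"
    and \<alpha>: "\<alpha> permutes {1..m}" and \<gamma>: "\<gamma> permutes {1..k}"
    and x: "occurs (dominating D k \<gamma> \<pi>) \<pi> m \<alpha> x"
  shows "\<exists>w. occurs D \<pi> (m + k) (block_perm m \<alpha> k \<gamma>) w"
proof -
  have "Min ((\<lambda>j. \<pi> (x j)) ` {1..m}) \<in> (\<lambda>j. \<pi> (x j)) ` {1..m}"
    using m by (intro Min_in) auto
  then obtain j0 where j0: "j0 \<in> {1..m}" "\<pi> (x j0) = Min ((\<lambda>j. \<pi> (x j)) ` {1..m})"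
    by auto
  have min: "\<pi> (x j0) \<le> \<pi> (x j)" if "j \<in> {1..m}" for j using that by (simp add: j0)
  have "(x m, \<pi> (x j0)) \<in> dominating D k \<gamma> \<pi>" using occursD(3)[OF x, of m j0] m j0 by simp
  then obtain z where z: "occurs D \<pi> k \<gamma> z"
    and xz: "\<And>i. i \<in> {1..k} \<Longrightarrow> x m < z i" and \<pi>z: "\<And>i. i \<in> {1..k} \<Longrightarrow> \<pi> (z i) < \<pi> (x j0)"
    by (rule dominatingE) blast
  have left: "x i < z j" if "i \<in> {1..m}" "j \<in> {1..k}" for i j
    using occursD(1)[OF x, of i m] xz[of j] that by (cases "i = m") auto
  have above: "\<pi> (z j) < \<pi> (x i)" if "i \<in> {1..m}" "j \<in> {1..k}" for i j
    using min[of i] \<pi>z[of j] that by linarith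
  have xD: "(x i, \<pi> (x j)) \<in> D" if "i \<in> {1..m}" "j \<in> {1..m}" for i j
    using occursD(3)[OF x that] dominating_subset by blast
  let ?b = "block_perm m \<alpha> k \<gamma>"
  define w where "w i = (if i \<le> m then x i else z (i - m))" for i
  have "occurs D \<pi> (m + k) ?b w"
    unfolding occurs_def
  proof (intro conjI ballI strict_mono_onI)
    fix i j assume ij: "i \<in> {1..m + k}" "j \<in> {1..m + k}"
    consider (xx) "i \<in> {1..m}" "j \<in> {1..m}"
      | (xz) j' where "i \<in> {1..m}" "j = m + j'" "j' \<in> {1..k}"
      | (zx) i' where "i = m + i'" "i' \<in> {1..k}" "j \<in> {1..m}"
      | (zz) i' j' where "i = m + i'" "i' \<in> {1..k}" "j = m + j'" "j' \<in> {1..k}"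
    proof -
      have "i \<in> {1..m} \<or> i = m + (i - m) \<and> i - m \<in> {1..k}"
           "j \<in> {1..m} \<or> j = m + (j - m) \<and> j - m \<in> {1..k}" using ij by auto
      then show thesis using that by metis
    qed
    then have "(i < j \<longrightarrow> w i < w j) \<and> (\<pi> (w i) < \<pi> (w j) \<longleftrightarrow> ?b i < ?b j) \<and> (w i, \<pi> (w j)) \<in> D"
    proof cases
      case xx
      then show ?thesis using occursD(1,2)[OF x xx] xD[OF xx] by (auto simp: w_def block_perm_def)
    next
      case xz
      have "(x i, \<pi> (z j')) \<in> D"
        using left[OF xz(1,3)] up_leftD[OF D xD[OF xz(1,1)]] up_leftD[OF D occursD(3)[OF z xz(3,3)]]
        by (intro up_left_mono[OF D occursD(3)[OF z xz(3,3)]]) auto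
      then show ?thesis
        using xz left[of i j'] above[of i j'] permutes_in_image[OF \<gamma>, of j'] permutes_in_image[OF \<alpha>, of i]
        by (auto simp: w_def block_perm_def)
    next
      case zx
      have "(z i', \<pi> (x j)) \<in> D"
        using above[OF zx(3,2)] up_leftD[OF D xD[OF zx(3,3)]] up_leftD[OF D occursD(3)[OF z zx(2,2)]]
        by (intro up_left_mono[OF D occursD(3)[OF z zx(2,2)]]) auto
      then show ?thesis
        using zx above[of j i'] permutes_in_image[OF \<gamma>, of i'] permutes_in_image[OF \<alpha>, of j]
        by (auto simp: w_def block_perm_def)
    next
      case zz
      then show ?thesis using occursD[OF z zz(2,4)] by (auto simp: w_def block_perm_def)
    qed
    then show "i < j \<Longrightarrow> w i < w j" "\<pi> (w i) < \<pi> (w j) \<longleftrightarrow> ?b i < ?b j" "(w i, \<pi> (w j)) \<in> D"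
      by blast+
  qed
  then show ?thesis by blast
qed

text \<open>The dominating set of \<open>\<pi>\<close> depends only on the part of \<open>\<pi>\<close> outside it.\<close>

lemma dominating_eqI:
  fixes \<pi> \<pi>' :: "nat \<Rightarrow> nat"
  assumes D: "up_left n D"
    and off: "\<And>x. (x, \<pi> x) \<notin> dominating D k \<gamma> \<pi> \<Longrightarrow> \<pi>' x = \<pi> x"
    and on: "\<And>x. (x, \<pi> x) \<in> dominating D k \<gamma> \<pi> \<Longrightarrow> (x, \<pi>' x) \<in> dominating D k \<gamma> \<pi>"
  shows "dominating D k \<gamma> \<pi>' = dominating D k \<gamma> \<pi>"
proof (rule antisym; rule subrelI)
  let ?W = "dominating D k \<gamma> \<pi>"
  note W = up_left_dominating[OF D, of k \<gamma> \<pi>]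
  fix x y assume xy: "(x, y) \<in> ?W"
  define S where "S = {(u, v) \<in> ?W. x \<le> u \<and> v \<le> y}"
  have "finite S"
    by (rule finite_subset[of _ "{1..n} \<times> {1..n}"]) (use W in \<open>auto simp: S_def up_left_def\<close>)
  moreover have "(x, y) \<in> S" using xy by (simp add: S_def)
  ultimately have "Max (fst ` S) \<in> fst ` S" and le: "\<And>q. q \<in> S \<Longrightarrow> fst q \<le> Max (fst ` S)"
    by (auto intro!: Max_in)
  then obtain q where q: "q \<in> S" "\<And>q'. q' \<in> S \<Longrightarrow> fst q' \<le> fst q"
    by fastforce
  obtain u v where uv: "q = (u, v)" by (cases q)
  have uvS: "(u, v) \<in> ?W" "x \<le> u" "v \<le> y" using q(1) by (auto simp: uv S_def)
  from uvS(1) obtain z where z: "occurs D \<pi> k \<gamma> z"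
    "\<And>i. i \<in> {1..k} \<Longrightarrow> u < z i" "\<And>i. i \<in> {1..k} \<Longrightarrow> \<pi> (z i) < v"
    by (rule dominatingE) blast
  \<comment> \<open>As \<open>u\<close> is maximal, this occurrence lies outside the dominating set.\<close>
  have eq: "\<pi>' (z i) = \<pi> (z i)" if i: "i \<in> {1..k}" for i
  proof (rule off, rule notI)
    assume "(z i, \<pi> (z i)) \<in> ?W"
    then have "(z i, \<pi> (z i)) \<in> S" using z(2,3)[OF i] uvS by (auto simp: S_def)
    then show False using q(2) z(2)[OF i] by (fastforce simp: uv)
  qed
  have "occurs D \<pi>' k \<gamma> z" using z(1) eq occurs_cong[of k \<pi>' z \<pi>] by blast
  then show "(x, y) \<in> dominating D k \<gamma> \<pi>'"
    using xy z(2,3) uvS eq subsetD[OF dominating_subset xy]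
    by (intro dominatingI[of _ _ _ _ _ _ z]) (auto intro: less_le_trans le_less_trans)
next
  let ?W = "dominating D k \<gamma> \<pi>"
  note W = up_left_dominating[OF D, of k \<gamma> \<pi>]
  fix x y assume "(x, y) \<in> dominating D k \<gamma> \<pi>'"
  then obtain z where xy: "(x, y) \<in> D" and z: "occurs D \<pi>' k \<gamma> z"
    "\<And>i. i \<in> {1..k} \<Longrightarrow> x < z i" "\<And>i. i \<in> {1..k} \<Longrightarrow> \<pi>' (z i) < y"
    by (rule dominatingE) blast
  show "(x, y) \<in> ?W"
  proof (rule ccontr)
    assume no: "(x, y) \<notin> ?W"
    have eq: "\<pi>' (z i) = \<pi> (z i)" if i: "i \<in> {1..k}" for i
    proof (rule off, rule notI)
      assume "(z i, \<pi> (z i)) \<in> ?W"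
      then have "(z i, \<pi>' (z i)) \<in> ?W" by (rule on)
      then have "(x, y) \<in> ?W"
        by (rule up_left_mono[OF W]) (use z(2,3)[OF i] up_leftD[OF D xy] in auto)
      then show False using no by simp
    qed
    have "occurs D \<pi> k \<gamma> z" using z(1) eq occurs_cong[of k \<pi>' z \<pi>] by blast
    then have "(x, y) \<in> ?W" using xy z(2,3) eq by (intro dominatingI[of _ _ _ _ _ _ z]) auto
    then show False using no by simp
  qed
qed

section \<open>Relabelling a class of transversals\<close>

text \<open>The permutations that agree with \<open>\<pi>\<^sub>0\<close> in the columns where \<open>\<pi>\<^sub>0\<close> lies outside \<open>W\<close>, and lie
  in \<open>W\<close> in the remaining columns.\<close>

definition fibre :: "nat \<Rightarrow> (nat \<times> nat) set \<Rightarrow> (nat \<Rightarrow> nat) \<Rightarrow> (nat \<Rightarrow> nat) set" where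
  "fibre n W \<pi>\<^sub>0 = {\<pi>. \<pi> permutes {1..n} \<and>
     (\<forall>x. (x, \<pi>\<^sub>0 x) \<notin> W \<longrightarrow> \<pi> x = \<pi>\<^sub>0 x) \<and> (\<forall>x. (x, \<pi>\<^sub>0 x) \<in> W \<longrightarrow> (x, \<pi> x) \<in> W)}"

lemma fibreD:
  assumes "\<pi> \<in> fibre n W \<pi>\<^sub>0"
  shows "\<pi> permutes {1..n}" "(x, \<pi>\<^sub>0 x) \<notin> W \<Longrightarrow> \<pi> x = \<pi>\<^sub>0 x" "(x, \<pi> x) \<in> W \<longleftrightarrow> (x, \<pi>\<^sub>0 x) \<in> W"
proof -
  have 1: "\<pi> permutes {1..n}" and 2: "(x, \<pi>\<^sub>0 x) \<notin> W \<Longrightarrow> \<pi> x = \<pi>\<^sub>0 x"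
    and 3: "(x, \<pi>\<^sub>0 x) \<in> W \<Longrightarrow> (x, \<pi> x) \<in> W" for x
    using assms unfolding fibre_def by blast+
  show "\<pi> permutes {1..n}" "(x, \<pi>\<^sub>0 x) \<notin> W \<Longrightarrow> \<pi> x = \<pi>\<^sub>0 x" by (fact 1 2)+
  show "(x, \<pi> x) \<in> W \<longleftrightarrow> (x, \<pi>\<^sub>0 x) \<in> W" using 2[of x] 3[of x] by (cases "(x, \<pi>\<^sub>0 x) \<in> W") simp_all
qed

lemma strict_mono_enumeration:
  fixes X :: "nat set"
  assumes "finite X"
  obtains c where "bij_betw c {1..card X} X" "strict_mono_on {1..card X} c"
proof -
  obtain h where h: "bij_betw h {..<card X} X" "strict_mono_on {..<card X} h"
    by (rule ex_bij_betw_strict_mono_card[OF assms])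
  have "bij_betw (\<lambda>i. i - 1) {1..card X} {..<card X}"
    by (rule bij_betw_byWitness[where f' = Suc]) auto
  then have "bij_betw (h \<circ> (\<lambda>i. i - 1)) {1..card X} X"
    using h(1) by (rule bij_betw_trans)
  moreover have "strict_mono_on {1..card X} (h \<circ> (\<lambda>i. i - 1))"
  proof (rule strict_mono_onI)
    fix i j assume "i \<in> {1..card X}" "j \<in> {1..card X}" "i < j"
    then have "h (i - 1) < h (j - 1)" by (intro strict_mono_onD[OF h(2)]) auto
    then show "(h \<circ> (\<lambda>i. i - 1)) i < (h \<circ> (\<lambda>i. i - 1)) j" by simp
  qed
  ultimately show thesis by (rule that)
qed

lemma strict_mono_on_le_iff:
  fixes c :: "nat \<Rightarrow> nat"
  assumes "strict_mono_on S c" "i \<in> S" "j \<in> S"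
  shows "c i < c j \<longleftrightarrow> i < j" "c i \<le> c j \<longleftrightarrow> i \<le> j"
  using strict_mono_onD[OF assms(1,2,3)] strict_mono_onD[OF assms(1,3,2)]
  by (cases i j rule: linorder_cases, auto)+

text \<open>Deleting the columns and rows of the fixed cells, and renumbering those that remain, turns a
  fibre into the set of all transversals of a proper Young diagram. Occurrences are preserved.\<close>

lemma fibre_relabel:
  assumes W: "up_left n W" and \<pi>\<^sub>0: "\<pi>\<^sub>0 permutes {1..n}" and ne: "\<exists>x. (x, \<pi>\<^sub>0 x) \<in> W"
  obtains a \<Phi> where "proper_young_diagram a"
    "bij_betw \<Phi> {\<sigma>. transversal a \<sigma>} (fibre n W \<pi>\<^sub>0)"
    "\<And>\<sigma> l \<rho>. transversal a \<sigma> \<Longrightarrow>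
       (\<exists>x. occurs W (\<Phi> \<sigma>) l \<rho> x) \<longleftrightarrow> (\<exists>x. occurs (cells a) \<sigma> l \<rho> x)"
proof -
  define X where "X = {x. (x, \<pi>\<^sub>0 x) \<in> W}"
  define p where "p = card X"
  have XN: "X \<subseteq> {1..n}" using up_leftD[OF W] by (auto simp: X_def)
  have finX: "finite X" by (rule finite_subset[OF XN]) simp
  have inj0: "inj_on \<pi>\<^sub>0 S" for S using permutes_inj[OF \<pi>\<^sub>0] by (rule inj_on_subset) simp
  define R where "R = \<pi>\<^sub>0 ` X"
  have finR: "finite R" and cardR: "card R = p"
    using finX card_image[OF inj0] by (auto simp: R_def p_def)
  have p1: "1 \<le> p" using ne finX by (auto simp: p_def X_def Suc_le_eq card_gt_0_iff)
  obtain c where c: "bij_betw c {1..p} X" "strict_mono_on {1..p} c"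
    using strict_mono_enumeration[OF finX] by (auto simp: p_def)
  obtain r where r: "bij_betw r {1..p} R" "strict_mono_on {1..p} r"
    using strict_mono_enumeration[OF finR] by (auto simp: cardR)
  define c' where "c' = inv_into {1..p} c"
  define r' where "r' = inv_into {1..p} r"
  have c': "bij_betw c' X {1..p}" and r': "bij_betw r' R {1..p}"
    using c r bij_betw_inv_into by (auto simp: c'_def r'_def)
  have cX: "c i \<in> X" "c' (c i) = i" if "i \<in> {1..p}" for i
    using that c(1) bij_betw_inv_into_left[OF c(1)] by (auto simp: c'_def bij_betw_def)
  have c'P: "c' x \<in> {1..p}" "c (c' x) = x" if "x \<in> X" for x
    using that bij_betwE[OF c'] bij_betw_inv_into_right[OF c(1)] by (auto simp: c'_def)
  have rR: "r j \<in> R" "r' (r j) = j" if "j \<in> {1..p}" for j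
    using that r(1) bij_betw_inv_into_left[OF r(1)] by (auto simp: r'_def bij_betw_def)
  have r'P: "r' y \<in> {1..p}" "r (r' y) = y" if "y \<in> R" for y
    using that bij_betwE[OF r'] bij_betw_inv_into_right[OF r(1)] by (auto simp: r'_def)
  have RN: "R \<subseteq> {1..n}" using XN permutes_image[OF \<pi>\<^sub>0] by (auto simp: R_def)
  have compl: "\<pi>\<^sub>0 ` ({1..n} - X) = {1..n} - R"
    using image_set_diff[OF permutes_inj[OF \<pi>\<^sub>0]] permutes_image[OF \<pi>\<^sub>0] by (simp add: R_def)
  \<comment> \<open>\<open>c\<close> and \<open>r\<close> enumerate the remaining columns and rows, \<open>E\<close> is \<open>W\<close> renumbered.\<close>
  define E where "E = {(i, j). i \<in> {1..p} \<and> j \<in> {1..p} \<and> (c i, r j) \<in> W}"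
  have E: "up_left p E"
    unfolding up_left_def
  proof (intro conjI allI impI)
    show "E \<subseteq> {1..p} \<times> {1..p}" by (auto simp: E_def)
    fix i j i' j' assume h: "(i, j) \<in> E" "1 \<le> i'" "i' \<le> i" "j \<le> j'" "j' \<le> p"
    then have P: "i \<in> {1..p}" "j \<in> {1..p}" "i' \<in> {1..p}" "j' \<in> {1..p}" and ij: "(c i, r j) \<in> W"
      by (auto simp: E_def)
    have "c i' \<le> c i" "r j \<le> r j'"
      using strict_mono_on_le_iff(2)[OF c(2) P(3,1)] strict_mono_on_le_iff(2)[OF r(2) P(2,4)] h
      by auto
    moreover have "c i' \<in> {1..n}" "r j' \<in> {1..n}" using cX(1)[OF P(3)] rR(1)[OF P(4)] XN RN by auto
    ultimately have "(c i', r j') \<in> W" by (intro up_left_mono[OF W ij]) auto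
    then show "(i', j') \<in> E" using P by (simp add: E_def)
  qed
  define \<Phi> where "\<Phi> \<sigma> x = (if x \<in> X then r (\<sigma> (c' x)) else \<pi>\<^sub>0 x)" for \<sigma> :: "nat \<Rightarrow> nat" and x
  define \<Psi> where "\<Psi> \<pi> i = (if i \<in> {1..p} then r' (\<pi> (c i)) else i)" for \<pi> :: "nat \<Rightarrow> nat" and i
  have fibre_R: "bij_betw \<pi> X R" if \<pi>: "\<pi> \<in> fibre n W \<pi>\<^sub>0" for \<pi>
  proof -
    note perm = fibreD(1)[OF \<pi>]
    have "\<pi> ` ({1..n} - X) = \<pi>\<^sub>0 ` ({1..n} - X)"
      using fibreD(2)[OF \<pi>] by (intro image_cong) (auto simp: X_def)
    then have "{1..n} - \<pi> ` X = {1..n} - R"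
      using image_set_diff[OF permutes_inj[OF perm]] permutes_image[OF perm] compl by simp
    moreover have "\<pi> ` X \<subseteq> {1..n}" using permutes_image[OF perm] XN by auto
    ultimately have "\<pi> ` X = R" using RN by blast
    moreover have "inj_on \<pi> X" using permutes_inj[OF perm] by (rule inj_on_subset) simp
    ultimately show ?thesis by (simp add: bij_betw_def)
  qed
  have \<Psi>: "\<Psi> \<pi> permutes {1..p}" "\<And>i. i \<in> {1..p} \<Longrightarrow> (i, \<Psi> \<pi> i) \<in> E"
    if \<pi>: "\<pi> \<in> fibre n W \<pi>\<^sub>0" for \<pi>
  proof -
    have "bij_betw (r' \<circ> (\<pi> \<circ> c)) {1..p} {1..p}"
      using c(1) fibre_R[OF \<pi>] r' by (intro bij_betw_trans)
    then have "bij_betw (\<Psi> \<pi>) {1..p} {1..p}"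
      by (rule bij_betw_cong[THEN iffD1, rotated]) (simp add: \<Psi>_def)
    then show "\<Psi> \<pi> permutes {1..p}" by (rule bij_imp_permutes) (auto simp: \<Psi>_def)
    fix i assume i: "i \<in> {1..p}"
    have "\<pi> (c i) \<in> R" using bij_betwE[OF fibre_R[OF \<pi>]] cX(1)[OF i] by blast
    moreover have "(c i, \<pi> (c i)) \<in> W" using cX(1)[OF i] fibreD(3)[OF \<pi>] by (simp add: X_def)
    ultimately show "(i, \<Psi> \<pi> i) \<in> E" using i r'P by (simp add: \<Psi>_def E_def)
  qed
  \<comment> \<open>The renumbered \<open>\<pi>\<^sub>0\<close> is the transversal that makes \<open>E\<close> a proper diagram.\<close>
  have self: "\<pi>\<^sub>0 \<in> fibre n W \<pi>\<^sub>0" using \<pi>\<^sub>0 by (simp add: fibre_def)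
  obtain a where a: "proper_young_diagram a" "length a = p" "cells a = E"
    using up_left_is_proper_diagram[OF E p1 \<Psi>[OF self]] by blast
  have trans: "transversal a \<sigma> \<longleftrightarrow> \<sigma> permutes {1..p} \<and> (\<forall>i\<in>{1..p}. (i, \<sigma> i) \<in> E)" for \<sigma>
    by (simp add: transversal_def a)
  have \<Phi>: "\<Phi> \<sigma> \<in> fibre n W \<pi>\<^sub>0" if \<sigma>: "transversal a \<sigma>" for \<sigma>
  proof -
    have "bij_betw (r \<circ> (\<sigma> \<circ> c')) X R"
      using c' permutes_imp_bij[of \<sigma> "{1..p}"] r(1) \<sigma> by (intro bij_betw_trans) (auto simp: trans)
    then have 1: "bij_betw (\<Phi> \<sigma>) X R"
      by (rule bij_betw_cong[THEN iffD1, rotated]) (simp add: \<Phi>_def)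
    have "bij_betw \<pi>\<^sub>0 ({1..n} - X) ({1..n} - R)" using inj0 compl by (simp add: bij_betw_def)
    then have 2: "bij_betw (\<Phi> \<sigma>) ({1..n} - X) ({1..n} - R)"
      by (rule bij_betw_cong[THEN iffD1, rotated]) (simp add: \<Phi>_def)
    have "bij_betw (\<Phi> \<sigma>) (X \<union> ({1..n} - X)) (R \<union> ({1..n} - R))"
      by (rule bij_betw_combine[OF 1 2]) blast
    moreover have "X \<union> ({1..n} - X) = {1..n}" "R \<union> ({1..n} - R) = {1..n}" using XN RN by auto
    ultimately have "bij_betw (\<Phi> \<sigma>) {1..n} {1..n}" by simp
    moreover have "\<Phi> \<sigma> x = x" if "x \<notin> {1..n}" for x
      using that XN permutes_not_in[OF \<pi>\<^sub>0] by (auto simp: \<Phi>_def)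
    ultimately have "\<Phi> \<sigma> permutes {1..n}" by (rule bij_imp_permutes)
    moreover have "(x, \<Phi> \<sigma> x) \<in> W" if x: "x \<in> X" for x
    proof -
      have "(c' x, \<sigma> (c' x)) \<in> E" using \<sigma> c'P(1)[OF x] by (simp add: trans)
      then show ?thesis using c'P(2)[OF x] x by (simp add: E_def \<Phi>_def)
    qed
    ultimately show ?thesis by (auto simp: fibre_def X_def \<Phi>_def)
  qed
  have bij: "bij_betw \<Phi> {\<sigma>. transversal a \<sigma>} (fibre n W \<pi>\<^sub>0)"
  proof (rule bij_betw_byWitness[where f' = \<Psi>])
    show "\<forall>\<sigma>\<in>{\<sigma>. transversal a \<sigma>}. \<Psi> (\<Phi> \<sigma>) = \<sigma>"
    proof (intro ballI ext)
      fix \<sigma> i assume "\<sigma> \<in> {\<sigma>. transversal a \<sigma>}"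
      then have \<sigma>: "\<sigma> permutes {1..p}" by (simp add: trans)
      show "\<Psi> (\<Phi> \<sigma>) i = \<sigma> i"
      proof (cases "i \<in> {1..p}")
        case True
        then have "\<sigma> i \<in> {1..p}" using permutes_in_image[OF \<sigma>] by blast
        then show ?thesis using True cX[OF True] rR(2) by (simp add: \<Psi>_def \<Phi>_def)
      next
        case False
        then show ?thesis using permutes_not_in[OF \<sigma> False] by (simp only: \<Psi>_def if_False)
      qed
    qed
    show "\<forall>\<pi>\<in>fibre n W \<pi>\<^sub>0. \<Phi> (\<Psi> \<pi>) = \<pi>"
    proof (intro ballI ext)
      fix \<pi> x assume \<pi>: "\<pi> \<in> fibre n W \<pi>\<^sub>0"
      show "\<Phi> (\<Psi> \<pi>) x = \<pi> x"
      proof (cases "x \<in> X")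
        case True
        then have "\<pi> x \<in> R" using bij_betwE[OF fibre_R[OF \<pi>]] by blast
        then show ?thesis using True c'P[OF True] r'P(2) by (simp add: \<Psi>_def \<Phi>_def)
      next
        case False
        then show ?thesis using fibreD(2)[OF \<pi>, of x] by (simp add: \<Phi>_def X_def)
      qed
    qed
    show "\<Phi> ` {\<sigma>. transversal a \<sigma>} \<subseteq> fibre n W \<pi>\<^sub>0" using \<Phi> by blast
    show "\<Psi> ` fibre n W \<pi>\<^sub>0 \<subseteq> {\<sigma>. transversal a \<sigma>}" using \<Psi> by (auto simp: trans)
  qed
  have transfer: "occurs W (\<Phi> \<sigma>) l \<rho> (c \<circ> x) \<longleftrightarrow> occurs (cells a) \<sigma> l \<rho> x"
    if \<sigma>: "transversal a \<sigma>" and x: "\<And>i. i \<in> {1..l} \<Longrightarrow> x i \<in> {1..p}" for \<sigma> l \<rho> x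
  proof -
    have \<sigma>x: "\<sigma> (x i) \<in> {1..p}" if "i \<in> {1..l}" for i
      using \<sigma> permutes_in_image[of \<sigma> "{1..p}"] x[OF that] unfolding trans by blast
    have \<Phi>x: "\<Phi> \<sigma> (c (x i)) = r (\<sigma> (x i))" if "i \<in> {1..l}" for i
      using cX[OF x[OF that]] by (simp add: \<Phi>_def)
    have "strict_mono_on {1..l} (c \<circ> x) \<longleftrightarrow> strict_mono_on {1..l} x"
      using strict_mono_on_le_iff(1)[OF c(2) x x] by (simp add: monotone_on_def)
    then show ?thesis
      using x \<sigma>x strict_mono_on_le_iff(1)[OF r(2) \<sigma>x \<sigma>x]
      unfolding occurs_def a E_def by (simp add: \<Phi>x del: atLeastAtMost_iff)
  qed
  have occ: "(\<exists>x. occurs W (\<Phi> \<sigma>) l \<rho> x) \<longleftrightarrow> (\<exists>x. occurs (cells a) \<sigma> l \<rho> x)"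
    if \<sigma>: "transversal a \<sigma>" for \<sigma> l \<rho>
  proof
    assume "\<exists>x. occurs W (\<Phi> \<sigma>) l \<rho> x"
    then obtain y where y: "occurs W (\<Phi> \<sigma>) l \<rho> y" ..
    have yX: "y i \<in> X" if "i \<in> {1..l}" for i
      using occursD(3)[OF y that that] fibreD(3)[OF \<Phi>[OF \<sigma>]] by (simp add: X_def)
    have "occurs W (\<Phi> \<sigma>) l \<rho> (c \<circ> (c' \<circ> y))"
      using y c'P(2)[OF yX] unfolding occurs_def by (simp add: monotone_on_def)
    then show "\<exists>x. occurs (cells a) \<sigma> l \<rho> x"
      using transfer[OF \<sigma>, of l "c' \<circ> y" \<rho>] c'P(1)[OF yX] by auto
  next
    assume "\<exists>x. occurs (cells a) \<sigma> l \<rho> x"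
    then obtain x where x: "occurs (cells a) \<sigma> l \<rho> x" ..
    then have "x i \<in> {1..p}" if "i \<in> {1..l}" for i
      using occursD(3)[OF x that that] by (auto simp: a E_def)
    then show "\<exists>x. occurs W (\<Phi> \<sigma>) l \<rho> x" using transfer[OF \<sigma>] x by blast
  qed
  show thesis using that[OF a(1) bij occ] .
qed

lemma card_fibre_avoiders_le:
  assumes le: "shape_le m \<alpha> m' \<beta>" and m: "1 \<le> m" "1 \<le> m'"
    and W: "up_left n W" and \<pi>\<^sub>0: "\<pi>\<^sub>0 permutes {1..n}"
  shows "card {\<pi> \<in> fibre n W \<pi>\<^sub>0. \<not> (\<exists>x. occurs W \<pi> m \<alpha> x)}
       \<le> card {\<pi> \<in> fibre n W \<pi>\<^sub>0. \<not> (\<exists>x. occurs W \<pi> m' \<beta> x)}"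
proof (cases "\<exists>x. (x, \<pi>\<^sub>0 x) \<in> W")
  case True
  obtain a \<Phi> where a: "proper_young_diagram a"
    and bij: "bij_betw \<Phi> {\<sigma>. transversal a \<sigma>} (fibre n W \<pi>\<^sub>0)"
    and occ: "\<And>\<sigma> l \<rho>. transversal a \<sigma> \<Longrightarrow>
       (\<exists>x. occurs W (\<Phi> \<sigma>) l \<rho> x) \<longleftrightarrow> (\<exists>x. occurs (cells a) \<sigma> l \<rho> x)"
    by (rule fibre_relabel[OF W \<pi>\<^sub>0 True]) (rule that)
  have "card (avoiders a l \<rho>) = card {\<pi> \<in> fibre n W \<pi>\<^sub>0. \<not> (\<exists>x. occurs W \<pi> l \<rho> x)}"
    if l: "1 \<le> l" for l \<rho>
  proof (rule bij_betw_same_card)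
    have iff: "\<sigma> \<in> avoiders a l \<rho> \<longleftrightarrow> transversal a \<sigma> \<and> \<not> (\<exists>x. occurs W (\<Phi> \<sigma>) l \<rho> x)" for \<sigma>
      using contains_in_iff_occurs[OF a _ l, of \<sigma> \<rho>] occ
      unfolding avoiders_def transversal_def by blast
    have "avoiders a l \<rho> \<subseteq> {\<sigma>. transversal a \<sigma>}" by (auto simp: avoiders_def)
    moreover have "\<Phi> ` avoiders a l \<rho> = {\<pi> \<in> fibre n W \<pi>\<^sub>0. \<not> (\<exists>x. occurs W \<pi> l \<rho> x)}"
    proof -
      have "avoiders a l \<rho> = {\<sigma>. transversal a \<sigma>} \<inter> {\<sigma>. \<not> (\<exists>x. occurs W (\<Phi> \<sigma>) l \<rho> x)}"
        using iff by blast
      then have "\<Phi> ` avoiders a l \<rho>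
          = \<Phi> ` {\<sigma>. transversal a \<sigma>} \<inter> {\<pi>. \<not> (\<exists>x. occurs W \<pi> l \<rho> x)}" by blast
      then show ?thesis unfolding bij_betw_imp_surj_on[OF bij] by blast
    qed
    ultimately show "bij_betw \<Phi> (avoiders a l \<rho>)
        {\<pi> \<in> fibre n W \<pi>\<^sub>0. \<not> (\<exists>x. occurs W \<pi> l \<rho> x)}"
      by (rule bij_betw_subset[OF bij])
  qed
  from this[OF m(1), of \<alpha>] this[OF m(2), of \<beta>] show ?thesis
    using le[unfolded shape_le_def, rule_format, OF a] by (simp only:)
next
  case False
  \<comment> \<open>The smaller diagram would be empty, so it is not proper; but nonempty patterns do not occur.\<close>
  have "\<not> occurs W \<pi> l \<rho> x" if "\<pi> \<in> fibre n W \<pi>\<^sub>0" "1 \<le> l" for \<pi> l \<rho> x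
    using occursD(3)[of W \<pi> l \<rho> x 1 1] fibreD(3)[OF that(1)] False that(2) by auto
  then have "{\<pi> \<in> fibre n W \<pi>\<^sub>0. \<not> (\<exists>x. occurs W \<pi> l \<rho> x)} = fibre n W \<pi>\<^sub>0" if "1 \<le> l" for l \<rho>
    using that by blast
  then show ?thesis using m by simp
qed

section \<open>Counting class by class\<close>

text \<open>The invariant of a transversal by which transversals are classified: its dominating set
  together with the part of its graph outside that set. The graph is taken over all naturals; its
  points beyond the diagram are the same for all transversals.\<close>

definition dominating_class ::
  "(nat \<times> nat) set \<Rightarrow> nat \<Rightarrow> (nat \<Rightarrow> nat) \<Rightarrow> (nat \<Rightarrow> nat) \<Rightarrow> (nat \<times> nat) set \<times> (nat \<times> nat) set" where
  "dominating_class D k \<gamma> \<pi> =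
     (dominating D k \<gamma> \<pi>, range (\<lambda>x. (x, \<pi> x)) - dominating D k \<gamma> \<pi>)"

lemma dominating_class_eq_iff:
  assumes a: "proper_young_diagram a" and \<pi>\<^sub>0: "transversal a \<pi>\<^sub>0"
  shows "transversal a \<pi> \<and> dominating_class (cells a) k \<gamma> \<pi> = dominating_class (cells a) k \<gamma> \<pi>\<^sub>0
    \<longleftrightarrow> \<pi> \<in> fibre (length a) (dominating (cells a) k \<gamma> \<pi>\<^sub>0) \<pi>\<^sub>0"
    (is "?L \<longleftrightarrow> _ \<in> fibre _ ?W _")
proof
  assume L: ?L
  then have W: "dominating (cells a) k \<gamma> \<pi> = ?W"
    by (simp add: dominating_class_def)
  from L have G: "range (\<lambda>x. (x, \<pi> x)) - ?W = range (\<lambda>x. (x, \<pi>\<^sub>0 x)) - ?W"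
    unfolding W[symmetric] dominating_class_def prod.inject by (simp only: W)
  have 1: "\<pi> x = \<pi>\<^sub>0 x" if "(x, \<pi>\<^sub>0 x) \<notin> ?W" for x
  proof -
    have "(x, \<pi>\<^sub>0 x) \<in> range (\<lambda>x. (x, \<pi> x)) - ?W" unfolding G using that by blast
    then show ?thesis by auto
  qed
  have 2: "(x, \<pi> x) \<in> ?W" if "(x, \<pi>\<^sub>0 x) \<in> ?W" for x
  proof (rule ccontr)
    assume "(x, \<pi> x) \<notin> ?W"
    then have "(x, \<pi> x) \<in> range (\<lambda>x. (x, \<pi>\<^sub>0 x)) - ?W" unfolding G[symmetric] by blast
    then show False using that by auto
  qed
  show "\<pi> \<in> fibre (length a) ?W \<pi>\<^sub>0" using 1 2 L by (simp add: fibre_def transversal_def)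
next
  assume \<pi>: "\<pi> \<in> fibre (length a) ?W \<pi>\<^sub>0"
  have W: "dominating (cells a) k \<gamma> \<pi> = ?W"
    using fibreD(2,3)[OF \<pi>] by (intro dominating_eqI[OF up_left_cells[OF a]]) auto
  have agree: "\<pi> x = \<pi>\<^sub>0 x" if "(x, \<pi> x) \<notin> ?W \<or> (x, \<pi>\<^sub>0 x) \<notin> ?W" for x
    using fibreD(2,3)[OF \<pi>, of x] that by blast
  have "range (\<lambda>x. (x, \<pi> x)) - ?W = range (\<lambda>x. (x, \<pi>\<^sub>0 x)) - ?W"
  proof (intro set_eqI iffI)
    fix q assume "q \<in> range (\<lambda>x. (x, \<pi> x)) - ?W"
    then obtain x where "q = (x, \<pi> x)" "q \<notin> ?W" by blast
    then have "q = (x, \<pi>\<^sub>0 x)" using agree[of x] by simp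
    then show "q \<in> range (\<lambda>x. (x, \<pi>\<^sub>0 x)) - ?W" using \<open>q \<notin> ?W\<close> by blast
  next
    fix q assume "q \<in> range (\<lambda>x. (x, \<pi>\<^sub>0 x)) - ?W"
    then obtain x where "q = (x, \<pi>\<^sub>0 x)" "q \<notin> ?W" by blast
    then have "q = (x, \<pi> x)" using agree[of x] by simp
    then show "q \<in> range (\<lambda>x. (x, \<pi> x)) - ?W" using \<open>q \<notin> ?W\<close> by blast
  qed
  moreover have "(x, \<pi> x) \<in> cells a" if "x \<in> {1..length a}" for x
  proof (cases "(x, \<pi> x) \<in> ?W")
    case True
    then show ?thesis using dominating_subset by blast
  next
    case False
    then show ?thesis using agree[of x] \<pi>\<^sub>0 that by (simp add: transversal_def)
  qed
  ultimately show ?L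
    using fibreD(1)[OF \<pi>] W by (simp add: transversal_def dominating_class_def)
qed

lemma card_le_fibrewise:
  assumes "finite A" "finite B" "\<And>y. card {x \<in> A. f x = y} \<le> card {x \<in> B. f x = y}"
  shows "card A \<le> card B"
proof -
  let ?Y = "f ` (A \<union> B)"
  have "card S = (\<Sum>y\<in>?Y. card {x \<in> S. f x = y})" if "finite S" "S \<subseteq> A \<union> B" for S
    using sum.group[of S ?Y f "\<lambda>_. 1::nat", OF that(1) _ image_mono[OF that(2)]] assms(1,2) by simp
  then have "card A = (\<Sum>y\<in>?Y. card {x \<in> A. f x = y})" "card B = (\<Sum>y\<in>?Y. card {x \<in> B. f x = y})"
    using assms(1,2) by auto
  then show ?thesis using assms(3) by (simp add: sum_mono)
qed

theorem proposition1:
  fixes m m' k :: nat and \<alpha> \<beta> \<gamma> :: "nat \<Rightarrow> nat"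
  assumes "1 \<le> m" and "\<alpha> permutes {1..m}"
    and "1 \<le> m'" and "\<beta> permutes {1..m'}"
    and "shape_le m \<alpha> m' \<beta>"
    and "1 \<le> k" and "\<gamma> permutes {1..k}"
  shows "shape_le (m + k) (block_perm m \<alpha> k \<gamma>) (m' + k) (block_perm m' \<beta> k \<gamma>)"
  unfolding shape_le_def
proof (intro allI impI)
  fix a assume a: "proper_young_diagram a"
  note D = up_left_cells[OF a]
  let ?W = "dominating (cells a) k \<gamma>"
  let ?cl = "dominating_class (cells a) k \<gamma>"
  have fin: "finite (avoiders a l \<rho>)" for l \<rho>
    by (rule finite_subset[of _ "{\<pi>. \<pi> permutes {1..length a}}"])
      (auto simp: avoiders_def transversal_def intro: finite_permutations)
  have avoid: "\<pi> \<in> avoiders a (l + k) (block_perm l \<rho> k \<gamma>)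
      \<longleftrightarrow> transversal a \<pi> \<and> \<not> (\<exists>x. occurs (?W \<pi>) \<pi> l \<rho> x)"
    if l: "1 \<le> l" and \<rho>: "\<rho> permutes {1..l}" for \<pi> l \<rho>
  proof -
    have "contains_in a \<pi> (l + k) (block_perm l \<rho> k \<gamma>) \<longleftrightarrow>
        (\<exists>x. occurs (cells a) \<pi> (l + k) (block_perm l \<rho> k \<gamma>) x)" if "transversal a \<pi>"
      using that l by (intro contains_in_iff_occurs[OF a]) (auto simp: transversal_def)
    moreover have "(\<exists>x. occurs (cells a) \<pi> (l + k) (block_perm l \<rho> k \<gamma>) x) \<longleftrightarrow>
        (\<exists>x. occurs (?W \<pi>) \<pi> l \<rho> x)"
      using occurs_block_imp_occurs_dominating[OF \<rho> assms(7)]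
        occurs_dominating_imp_occurs_block[OF D l \<rho> assms(7)] by blast
    ultimately show ?thesis unfolding avoiders_def by blast
  qed
  have class_eq: "{\<pi> \<in> avoiders a (l + k) (block_perm l \<rho> k \<gamma>). ?cl \<pi> = ?cl \<pi>\<^sub>0}
      = {\<pi> \<in> fibre (length a) (?W \<pi>\<^sub>0) \<pi>\<^sub>0. \<not> (\<exists>x. occurs (?W \<pi>\<^sub>0) \<pi> l \<rho> x)}"
    if l: "1 \<le> l" and \<rho>: "\<rho> permutes {1..l}" and \<pi>\<^sub>0: "transversal a \<pi>\<^sub>0" for l \<rho> \<pi>\<^sub>0
  proof -
    have W: "?W \<pi> = ?W \<pi>\<^sub>0" if "?cl \<pi> = ?cl \<pi>\<^sub>0" for \<pi>
      using that by (simp add: dominating_class_def)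
    show ?thesis
    proof (intro Collect_cong)
      fix \<pi>
      show "\<pi> \<in> avoiders a (l + k) (block_perm l \<rho> k \<gamma>) \<and> ?cl \<pi> = ?cl \<pi>\<^sub>0 \<longleftrightarrow>
          \<pi> \<in> fibre (length a) (?W \<pi>\<^sub>0) \<pi>\<^sub>0 \<and> \<not> (\<exists>x. occurs (?W \<pi>\<^sub>0) \<pi> l \<rho> x)"
      proof (cases "?cl \<pi> = ?cl \<pi>\<^sub>0")
        case True
        then show ?thesis
          using avoid[OF l \<rho>, of \<pi>] dominating_class_eq_iff[OF a \<pi>\<^sub>0, of \<pi> k \<gamma>] W[OF True] by simp
      next
        case False
        then show ?thesis using dominating_class_eq_iff[OF a \<pi>\<^sub>0, of \<pi> k \<gamma>] by blast
      qed
    qed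
  qed
  show "card (avoiders a (m + k) (block_perm m \<alpha> k \<gamma>))
      \<le> card (avoiders a (m' + k) (block_perm m' \<beta> k \<gamma>))"
  proof (rule card_le_fibrewise[OF fin fin, where f = ?cl])
    fix y
    show "card {\<pi> \<in> avoiders a (m + k) (block_perm m \<alpha> k \<gamma>). ?cl \<pi> = y}
        \<le> card {\<pi> \<in> avoiders a (m' + k) (block_perm m' \<beta> k \<gamma>). ?cl \<pi> = y}"
    proof (cases "\<exists>\<pi>\<^sub>0. transversal a \<pi>\<^sub>0 \<and> ?cl \<pi>\<^sub>0 = y")
      case True
      then obtain \<pi>\<^sub>0 where \<pi>\<^sub>0: "transversal a \<pi>\<^sub>0" and y: "y = ?cl \<pi>\<^sub>0" by blast
      show ?thesis
        unfolding y class_eq[OF assms(1,2) \<pi>\<^sub>0] class_eq[OF assms(3,4) \<pi>\<^sub>0]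
        using \<pi>\<^sub>0 by (intro card_fibre_avoiders_le[OF assms(5,1,3) up_left_dominating[OF D]])
          (simp add: transversal_def)
    next
      case False
      then have "{\<pi> \<in> avoiders a (m + k) (block_perm m \<alpha> k \<gamma>). ?cl \<pi> = y} = {}"
        by (auto simp: avoiders_def)
      then show ?thesis by (simp only: card.empty le0)
    qed
  qed
qed

end
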